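(* Let $m_1 \leq m_2 \leq m_3$ be three natural numbers. Then: (1) $box(TCC(m_1))=cub(TCC(m_1))=0$; (2) $box(TCC(m_1,m_2))=cub(TCC(m_1,m_2))=m_1$; (3) $box(TCC(m_1,m_2,m_3))=cub(TCC(m_1,m_2,m_3))=m_1+m_2$.
   Context: Natural numbers here are positive integers. All graphs are finite, simple and undirected. Boxicity and cubicity: a $k$-box (resp. $k$-cube) is a Cartesian product of $k$ closed intervals (resp. closed unit-length intervals) of $\mathbb{R}$. A $k$-box (resp. $k$-cube) representation of a graph $\Gamma$ is a function $f$ assigning to each vertex a $k$-box (resp. $k$-cube) such that two distinct vertices $u,v$ are adjacent if and only if $f(u)\cap f(v)\neq\emptyset$. The boxicity $box(\Gamma)$ (resp. cubicity $cub(\Gamma)$) is the smallest non-negative integer $k$ for which $\Gamma$ has a $k$-box (resp. $k$-cube) representation; complete graphs have boxicity and cubicity $0$. For positive integers $a_1,\dots,a_s$, $TCC(a_1,\dots,a_s)$ (the transitive closure of the Cartesian product of the complete graphs $K_{a_1+1},\dots,K_{a_s+1}$) is the graph whose vertices are the integer $s$-tuples $x=(x_1,\dots,x_s)$ with $0\leq x_i\leq a_i$ for all $i$, where two distinct vertices $x,y$ are adjacent if and only if either $x_i\leq y_i$ for all $i$, or $x_i\geq y_i$ for all $i$. *)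

theory Defs
  imports Complex_Main "HOL-Library.FuncSet"
begin

record 'a graph =
  verts :: "'a set"
  edges :: "'a set set"

definition finite_simple_graph :: "'a graph \<Rightarrow> bool" where
  "finite_simple_graph G \<longleftrightarrow>
     finite (verts G) \<and> (\<forall>e \<in> edges G. e \<subseteq> verts G \<and> card e = 2)"

definition adj :: "'a graph \<Rightarrow> 'a \<Rightarrow> 'a \<Rightarrow> bool" where
  "adj G u v \<longleftrightarrow> {u, v} \<in> edges G"

text \<open>
  Points of \<open>k\<close>-dimensional real space are the extensional functions on \<open>{..<k}\<close>. Intervals
  are nonempty and bounded. For \<open>k = 0\<close> the only box, and the only cube, is a single point.
\<close>

definition is_box :: "nat \<Rightarrow> (nat \<Rightarrow> real) set \<Rightarrow> bool" where
  "is_box k B \<longleftrightarrow>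
     (\<exists>l r. (\<forall>i<k. l i \<le> r i) \<and> B = (\<Pi>\<^sub>E i\<in>{..<k}. {l i..r i}))"

definition is_cube :: "nat \<Rightarrow> (nat \<Rightarrow> real) set \<Rightarrow> bool" where
  "is_cube k B \<longleftrightarrow> (\<exists>l. B = (\<Pi>\<^sub>E i\<in>{..<k}. {l i..l i + 1}))"

definition intersection_model :: "'a graph \<Rightarrow> ('a \<Rightarrow> 'b set) \<Rightarrow> bool" where
  "intersection_model G f \<longleftrightarrow>
     (\<forall>u \<in> verts G. \<forall>v \<in> verts G. u \<noteq> v \<longrightarrow> (adj G u v \<longleftrightarrow> f u \<inter> f v \<noteq> {}))"

definition box_representation :: "nat \<Rightarrow> 'a graph \<Rightarrow> ('a \<Rightarrow> (nat \<Rightarrow> real) set) \<Rightarrow> bool" where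
  "box_representation k G f \<longleftrightarrow> (\<forall>v \<in> verts G. is_box k (f v)) \<and> intersection_model G f"

definition cube_representation :: "nat \<Rightarrow> 'a graph \<Rightarrow> ('a \<Rightarrow> (nat \<Rightarrow> real) set) \<Rightarrow> bool" where
  "cube_representation k G f \<longleftrightarrow> (\<forall>v \<in> verts G. is_cube k (f v)) \<and> intersection_model G f"

definition boxicity :: "'a graph \<Rightarrow> nat" where
  "boxicity G = (LEAST k. \<exists>f. box_representation k G f)"

definition cubicity :: "'a graph \<Rightarrow> nat" where
  "cubicity G = (LEAST k. \<exists>f. cube_representation k G f)"

definition TCC :: "nat list \<Rightarrow> nat list graph" where
  "TCC a =
     (let V = {x. length x = length a \<and> (\<forall>i < length a. x ! i \<le> a ! i)}
      in \<lparr> verts = V,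
           edges = {{x, y} | x y. x \<in> V \<and> y \<in> V \<and> x \<noteq> y \<and>
                                  ((\<forall>i < length a. x ! i \<le> y ! i) \<or>
                                   (\<forall>i < length a. x ! i \<ge> y ! i))} \<rparr>)"

lemma verts_TCC:
  "verts (TCC a) = {x. length x = length a \<and> (\<forall>i < length a. x ! i \<le> a ! i)}"
  by (simp add: TCC_def)

lemma adj_TCC_iff:
  assumes "x \<in> verts (TCC a)" "y \<in> verts (TCC a)" "x \<noteq> y"
  shows "adj (TCC a) x y \<longleftrightarrow>
    (\<forall>i < length a. x ! i \<le> y ! i) \<or> (\<forall>i < length a. x ! i \<ge> y ! i)"
  using assms unfolding adj_def TCC_def Let_def by (auto simp: doubleton_eq_iff; blast)

lemma finite_simple_graph_TCC: "finite_simple_graph (TCC a)"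
proof -
  have "verts (TCC a) \<subseteq> {x. set x \<subseteq> {..Max (set a)} \<and> length x = length a}"
  proof
    fix x assume "x \<in> verts (TCC a)"
    hence len: "length x = length a" and le: "\<And>i. i < length a \<Longrightarrow> x ! i \<le> a ! i"
      by (auto simp: verts_TCC)
    have "x ! i \<le> Max (set a)" if "i < length a" for i
      using le[OF that] that by (meson List.finite_set Max_ge le_trans nth_mem)
    thus "x \<in> {x. set x \<subseteq> {..Max (set a)} \<and> length x = length a}"
      using len by (auto simp: in_set_conv_nth)
  qed
  moreover have "finite {x. set x \<subseteq> {..Max (set a)} \<and> length x = length a}"
    by (rule finite_lists_length_eq) simp
  ultimately have "finite (verts (TCC a))"
    by (rule finite_subset)
  thus ?thesis
    by (auto simp: finite_simple_graph_def TCC_def Let_def card_insert_if)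
qed

end

theory Submission
  imports Defs
begin

text \<open>
  Each coordinate of a box representation assigns intervals to the vertices, and a non-adjacent
  pair must be separated in some coordinate. Since interval graphs contain no induced 4-cycle, a
  coordinate that separates two vertices of one part of a join separates nothing inside any
  other part. Along a diagonal of the grid, consecutive points span unit cubes and unit squares
  that form a join. A square contains a non-adjacent pair and uses up at least one coordinate; a
  3-cube contains an induced 6-cycle (its atoms and coatoms) and uses up at least two. The
  triple \<open>(m1, m2, m3)\<close> gives \<open>m1\<close> cubes followed by \<open>m2 - m1\<close> squares.

  For the upper bound, a threshold \<open>t\<close> in direction \<open>c\<close> splits the grid into a lower and an upper
  part. Placing \<open>x\<close> at \<open>-g x\<close> or \<open>1 - g x\<close> accordingly, with \<open>g\<close> monotone and small, keeps
  comparable points at distance at most 1, and separates \<open>x\<close> below from \<open>y\<close> above the threshold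
  exactly when \<open>g x > g y\<close>. All thresholds in the directions of \<open>m1\<close> and \<open>m2\<close> suffice, with \<open>g\<close>
  governed by the last coordinate and one tie broken lexicographically.
\<close>

subsection \<open>Interval coordinates\<close>

definition separates :: "('a \<Rightarrow> nat \<Rightarrow> real) \<Rightarrow> ('a \<Rightarrow> nat \<Rightarrow> real) \<Rightarrow> nat \<Rightarrow> 'a \<Rightarrow> 'a \<Rightarrow> bool" where
  "separates l r i u v \<longleftrightarrow> r u i < l v i \<or> r v i < l u i"

text \<open>Intersection is taken factor by factor, and a product is empty exactly when a factor is.
  Nonempty intervals are disjoint only by lying side by side.\<close>

lemma PiE_intervals_disjoint_iff:
  fixes l r l' r' :: "'i \<Rightarrow> real"
  assumes "\<And>i. i \<in> I \<Longrightarrow> l i \<le> r i" "\<And>i. i \<in> I \<Longrightarrow> l' i \<le> r' i"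
  shows "(\<Pi>\<^sub>E i\<in>I. {l i..r i}) \<inter> (\<Pi>\<^sub>E i\<in>I. {l' i..r' i}) = {} \<longleftrightarrow>
    (\<exists>i\<in>I. r i < l' i \<or> r' i < l i)"
proof -
  have "{l i..r i} \<inter> {l' i..r' i} = {} \<longleftrightarrow> r i < l' i \<or> r' i < l i" if "i \<in> I" for i
    using assms[OF that] by auto
  thus ?thesis
    by (auto simp: PiE_Int PiE_eq_empty_iff)
qed

text \<open>Unpacks boxes into endpoint functions, so that the lower bounds reduce to linear
  inequalities within single coordinates.\<close>

lemma box_representationE:
  assumes "box_representation k G f"
  obtains l r where
    "\<And>v i. v \<in> verts G \<Longrightarrow> i < k \<Longrightarrow> l v i \<le> r v i"
    "\<And>u v. u \<in> verts G \<Longrightarrow> v \<in> verts G \<Longrightarrow> u \<noteq> v \<Longrightarrow>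
       adj G u v \<longleftrightarrow> (\<forall>i<k. \<not> separates l r i u v)"
proof -
  have "\<forall>v\<in>verts G. \<exists>l r. (\<forall>i<k. l i \<le> r i) \<and> f v = (\<Pi>\<^sub>E i\<in>{..<k}. {l i..r i})"
    using assms by (simp add: box_representation_def is_box_def)
  then obtain l r where lr: "\<And>v i. v \<in> verts G \<Longrightarrow> i < k \<Longrightarrow> l v i \<le> r v i"
      and f: "\<And>v. v \<in> verts G \<Longrightarrow> f v = (\<Pi>\<^sub>E i\<in>{..<k}. {l v i..r v i})"
    by metis
  have "adj G u v \<longleftrightarrow> (\<forall>i<k. \<not> separates l r i u v)"
    if "u \<in> verts G" "v \<in> verts G" "u \<noteq> v" for u v
  proof -
    have "adj G u v \<longleftrightarrow> f u \<inter> f v \<noteq> {}"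
      using assms that by (simp add: box_representation_def intersection_model_def)
    also have "\<dots> \<longleftrightarrow> (\<forall>i<k. \<not> separates l r i u v)"
      using that lr PiE_intervals_disjoint_iff[of "{..<k}" "l u" "r u" "l v" "r v"]
      by (simp add: f separates_def) blast
    finally show ?thesis .
  qed
  thus ?thesis
    using lr that by blast
qed

text \<open>Unit intervals meet exactly when their left ends differ by at most 1, so the left ends
  alone describe the cubes.\<close>

lemma cube_representation_of_positions:
  fixes \<phi> :: "nat \<Rightarrow> 'a \<Rightarrow> real"
  assumes "\<And>u v. u \<in> verts G \<Longrightarrow> v \<in> verts G \<Longrightarrow> u \<noteq> v \<Longrightarrow>
    adj G u v \<longleftrightarrow> (\<forall>i<k. \<bar>\<phi> i u - \<phi> i v\<bar> \<le> 1)"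
  shows "cube_representation k G (\<lambda>v. \<Pi>\<^sub>E i\<in>{..<k}. {\<phi> i v..\<phi> i v + 1})"
proof -
  have "(\<Pi>\<^sub>E i\<in>{..<k}. {\<phi> i u..\<phi> i u + 1}) \<inter> (\<Pi>\<^sub>E i\<in>{..<k}. {\<phi> i v..\<phi> i v + 1}) \<noteq> {} \<longleftrightarrow>
      (\<forall>i<k. \<bar>\<phi> i u - \<phi> i v\<bar> \<le> 1)" for u v
    by (subst PiE_intervals_disjoint_iff) (auto simp: abs_le_iff not_less algebra_simps)
  hence "intersection_model G (\<lambda>v. \<Pi>\<^sub>E i\<in>{..<k}. {\<phi> i v..\<phi> i v + 1})"
    unfolding intersection_model_def using assms by simp
  moreover have "is_cube k (\<Pi>\<^sub>E i\<in>{..<k}. {\<phi> i v..\<phi> i v + 1})" for v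
    unfolding is_cube_def by (rule exI) (rule refl)
  ultimately show ?thesis
    by (simp add: cube_representation_def)
qed

lemma box_representation_of_cube_representation:
  assumes "cube_representation k G f"
  shows "box_representation k G f"
proof -
  have "is_box k B" if cube: "is_cube k B" for B
  proof -
    obtain l where "B = (\<Pi>\<^sub>E i\<in>{..<k}. {l i..l i + 1})"
      using cube unfolding is_cube_def by blast
    thus ?thesis
      unfolding is_box_def by (intro exI[of _ l] exI[of _ "\<lambda>i. l i + 1"]) simp
  qed
  thus ?thesis
    using assms by (auto simp: box_representation_def cube_representation_def)
qed

text \<open>Cubes are boxes, so one cube construction bounds both parameters from above and one
  bound for boxes bounds both from below.\<close>

lemma boxicity_cubicity_eqI:
  assumes "cube_representation m G f"
    and "\<And>k f. box_representation k G f \<Longrightarrow> m \<le> k"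
  shows "boxicity G = m \<and> cubicity G = m"
  unfolding boxicity_def cubicity_def
  using assms box_representation_of_cube_representation
  by (intro conjI Least_equality) blast+

subsection \<open>Lower bounds\<close>

text \<open>Otherwise \<open>u\<close>, \<open>x\<close>, \<open>v\<close>, \<open>y\<close> would
  form an induced 4-cycle in an interval graph.\<close>

lemma separates_cross:
  assumes "separates l r i u v" "separates l r i x y"
  shows "separates l r i u x \<or> separates l r i u y \<or> separates l r i v x \<or> separates l r i v y"
  using assms unfolding separates_def by linarith

text \<open>The middle one of three disjoint intervals meets every interval that meets the other two.\<close>

lemma no_induced_hexagon:
  assumes "l a i \<le> r a i" "l b i \<le> r b i" "l c i \<le> r c i"
    and "separates l r i a b" "separates l r i b c" "separates l r i a c"
    and "separates l r i a bc" "separates l r i b ac" "separates l r i c ab"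
    and "\<not> separates l r i a ab" "\<not> separates l r i b ab" "\<not> separates l r i a ac"
      "\<not> separates l r i c ac" "\<not> separates l r i b bc" "\<not> separates l r i c bc"
  shows False
  using assms unfolding separates_def by linarith

text \<open>In a box representation, these coordinates alone already represent the subgraph induced
  on \<open>P\<close>.\<close>

definition active :: "nat \<Rightarrow> ('a \<Rightarrow> nat \<Rightarrow> real) \<Rightarrow> ('a \<Rightarrow> nat \<Rightarrow> real) \<Rightarrow> 'a set \<Rightarrow> nat set" where
  "active k l r P = {i. i < k \<and> (\<exists>u\<in>P. \<exists>v\<in>P. separates l r i u v)}"

lemma finite_active [simp]: "finite (active k l r P)"
  by (simp add: active_def)

text \<open>Parts of a join have disjoint active sets: a shared coordinate would separate a pair in
  each of two parts, hence by \<open>separates_cross\<close> a pair across them.\<close>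

lemma sum_card_active_le:
  fixes P :: "nat \<Rightarrow> 'a set"
  assumes cross: "\<And>p q u v i. p < q \<Longrightarrow> q < n \<Longrightarrow> u \<in> P p \<Longrightarrow> v \<in> P q \<Longrightarrow> i < k \<Longrightarrow>
    \<not> separates l r i u v"
  shows "(\<Sum>p<n. card (active k l r (P p))) \<le> k"
proof -
  have disj: "active k l r (P p) \<inter> active k l r (P q) = {}" if "p < q" "q < n" for p q
  proof (rule ccontr)
    assume "active k l r (P p) \<inter> active k l r (P q) \<noteq> {}"
    then obtain i u v x y where i: "i < k" "u \<in> P p" "v \<in> P p" "x \<in> P q" "y \<in> P q"
        "separates l r i u v" "separates l r i x y"
      by (auto simp: active_def)
    with separates_cross[of l r i u v x y] cross[OF that] show False
      by blast
  qed
  have "(\<Sum>p<n. card (active k l r (P p))) = card (\<Union>p<n. active k l r (P p))"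
  proof (rule card_UN_disjoint[symmetric])
    show "\<forall>p\<in>{..<n}. \<forall>q\<in>{..<n}. p \<noteq> q \<longrightarrow> active k l r (P p) \<inter> active k l r (P q) = {}"
    proof (intro ballI impI)
      fix p q assume "p \<in> {..<n}" "q \<in> {..<n}" "p \<noteq> q"
      thus "active k l r (P p) \<inter> active k l r (P q) = {}"
        using disj[of p q] disj[of q p] by (cases p q rule: linorder_cases) (auto simp: Int_commute)
    qed
  qed auto
  also have "\<dots> \<le> card {..<k}"
    by (intro card_mono) (auto simp: active_def)
  finally show ?thesis
    by simp
qed

lemma card_active_ge_1:
  assumes "u \<in> P" "v \<in> P" "\<exists>i<k. separates l r i u v"
  shows "1 \<le> card (active k l r P)"
proof -
  have "active k l r P \<noteq> {}"
    using assms unfolding active_def by blast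
  thus ?thesis
    by (simp add: Suc_le_eq card_gt_0_iff)
qed

text \<open>A single active coordinate would have to carry all six separations, which
  \<open>no_induced_hexagon\<close> excludes.\<close>

lemma card_active_hexagon_ge_2:
  assumes box: "\<And>u i. u \<in> {a, b, c} \<Longrightarrow> i < k \<Longrightarrow> l u i \<le> r u i"
    and nonadj: "\<And>u v. (u, v) \<in> {(a, b), (b, c), (a, c), (a, bc), (b, ac), (c, ab)} \<Longrightarrow>
      \<exists>i<k. separates l r i u v"
    and adj: "\<And>u v i. (u, v) \<in> {(a, ab), (b, ab), (a, ac), (c, ac), (b, bc), (c, bc)} \<Longrightarrow>
      i < k \<Longrightarrow> \<not> separates l r i u v"
  shows "2 \<le> card (active k l r {a, b, c, ab, ac, bc})"
proof (rule ccontr)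
  let ?A = "active k l r {a, b, c, ab, ac, bc}"
  assume "\<not> 2 \<le> card ?A"
  hence "card ?A \<le> Suc 0"
    by simp
  hence eq: "\<forall>i\<in>?A. \<forall>j\<in>?A. i = j"
    by (simp add: card_le_Suc0_iff_eq)
  obtain i where i: "i < k" "separates l r i a b"
    using nonadj[of a b] by auto
  hence iA: "i \<in> ?A"
    by (auto simp: active_def)
  have sep: "separates l r i u v"
    if uv: "(u, v) \<in> {(a, b), (b, c), (a, c), (a, bc), (b, ac), (c, ab)}" for u v
  proof -
    obtain j where j: "j < k" "separates l r j u v"
      using nonadj[OF uv] by blast
    hence "j \<in> ?A"
      using uv unfolding active_def by blast
    with iA eq j show ?thesis
      by auto
  qed
  show False
    by (rule no_induced_hexagon[of l a i r b c bc ac ab])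
      (use box sep adj i in \<open>simp_all\<close>)
qed

lemma box_TCC2_ge:
  assumes "m1 \<le> m2" and "box_representation k (TCC [m1, m2]) f"
  shows "m1 \<le> k"
proof -
  let ?G = "TCC [m1, m2]"
  obtain l r where
    adj: "\<And>u v. u \<in> verts ?G \<Longrightarrow> v \<in> verts ?G \<Longrightarrow> u \<noteq> v \<Longrightarrow>
       adj ?G u v \<longleftrightarrow> (\<forall>i<k. \<not> separates l r i u v)"
    using assms(2) by (elim box_representationE) blast
  \<comment> \<open>The incomparable corners of the \<open>p\<close>-th diagonal square. Their
    entries are at most \<open>p + 1\<close>, those of any later part at least \<open>p + 1\<close>,
    so the parts form a join.\<close>
  define P where "P p = {[p, p + 1], [p + 1, p]}" for p :: nat
  have P: "P p \<subseteq> verts ?G" if "p < m1" for p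
    using that assms(1) by (auto simp: P_def verts_TCC All_less_Suc2)
  have "(\<Sum>p<m1. 1) \<le> (\<Sum>p<m1. card (active k l r (P p)))"
  proof (rule sum_mono)
    fix p assume "p \<in> {..<m1}"
    hence p: "[p, p + 1] \<in> verts ?G" "[p + 1, p] \<in> verts ?G"
      using P[of p] by (auto simp: P_def)
    have "\<exists>i<k. separates l r i [p, p + 1] [p + 1, p]"
      using adj[OF p] adj_TCC_iff[OF p] by (auto simp: All_less_Suc2)
    thus "1 \<le> card (active k l r (P p))"
      by (intro card_active_ge_1) (auto simp: P_def)
  qed
  also have "\<dots> \<le> k"
  proof (rule sum_card_active_le)
    fix p q u v i assume A: "p < q" "q < m1" "u \<in> P p" "v \<in> P q" "i < k"
    hence uv: "u \<in> verts ?G" "v \<in> verts ?G" "u \<noteq> v"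
      using P[of p] P[of q] by (auto simp: P_def)
    have "adj ?G u v"
      using A by (auto simp: adj_TCC_iff[OF uv] P_def All_less_Suc2)
    thus "\<not> separates l r i u v"
      using adj[OF uv] A by blast
  qed
  finally show ?thesis
    by simp
qed

lemma box_TCC3_ge:
  assumes "m1 \<le> m2" "m2 \<le> m3" and "box_representation k (TCC [m1, m2, m3]) f"
  shows "m1 + m2 \<le> k"
proof -
  let ?G = "TCC [m1, m2, m3]"
  obtain l r where box: "\<And>v i. v \<in> verts ?G \<Longrightarrow> i < k \<Longrightarrow> l v i \<le> r v i"
    and adj: "\<And>u v. u \<in> verts ?G \<Longrightarrow> v \<in> verts ?G \<Longrightarrow> u \<noteq> v \<Longrightarrow>
       adj ?G u v \<longleftrightarrow> (\<forall>i<k. \<not> separates l r i u v)"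
    using assms(3) by (elim box_representationE) blast
  \<comment> \<open>Atoms and coatoms of the \<open>p\<close>-th diagonal cube; once the first
    coordinate is exhausted it stays at \<open>m1\<close> and squares in the other two
    remain.\<close>
  define P where "P p = (if p < m1
      then {[p + 1, p, p], [p, p + 1, p], [p, p, p + 1],
            [p + 1, p + 1, p], [p + 1, p, p + 1], [p, p + 1, p + 1]}
      else {[m1, p, p + 1], [m1, p + 1, p]})" for p :: nat
  have P: "P p \<subseteq> verts ?G" if "p < m2" for p
    using that assms(1,2) by (auto simp: P_def verts_TCC All_less_Suc2)
  have nonsep: "\<not> separates l r i u v"
    if "u \<in> verts ?G" "v \<in> verts ?G" "u \<noteq> v" "\<forall>j<3. u ! j \<le> v ! j" "i < k" for u v i
    using adj[OF that(1-3)] adj_TCC_iff[OF that(1-3)] that(4,5) by (auto simp: numeral_3_eq_3)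
  have sep: "\<exists>i<k. separates l r i u v"
    if "u \<in> verts ?G" "v \<in> verts ?G" "\<exists>j<3. u ! j < v ! j" "\<exists>j<3. v ! j < u ! j" for u v
  proof -
    have "u \<noteq> v" "\<not> (\<forall>j<3. u ! j \<le> v ! j)" "\<not> (\<forall>j<3. v ! j \<le> u ! j)"
      using that(3,4) by (auto simp: not_le)
    thus ?thesis
      using adj[OF that(1,2)] adj_TCC_iff[OF that(1,2)] by (simp add: numeral_3_eq_3) blast
  qed
  \<comment> \<open>Each of the \<open>m2\<close> parts accounts for one coordinate, and each of the
    \<open>m1\<close> cubes for a second one.\<close>
  have "{..<m2} \<inter> {p. p < m1} = {..<m1}"
    using assms(1) by auto
  hence "m1 + m2 = (\<Sum>p<m2. 1) + (\<Sum>p<m2. if p < m1 then 1 else 0)"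
    by (simp add: sum.If_cases)
  also have "\<dots> = (\<Sum>p<m2. 1 + (if p < m1 then 1 else 0))"
    by (simp only: sum.distrib)
  also have "\<dots> \<le> (\<Sum>p<m2. card (active k l r (P p)))"
  proof (rule sum_mono)
    fix p assume "p \<in> {..<m2}"
    hence V: "P p \<subseteq> verts ?G"
      using P by simp
    show "1 + (if p < m1 then 1 else 0) \<le> card (active k l r (P p))"
    proof (cases "p < m1")
      case True
      let ?a = "[p + 1, p, p]" and ?b = "[p, p + 1, p]" and ?c = "[p, p, p + 1]"
      let ?ab = "[p + 1, p + 1, p]" and ?ac = "[p + 1, p, p + 1]" and ?bc = "[p, p + 1, p + 1]"
      have W: "?a \<in> verts ?G" "?b \<in> verts ?G" "?c \<in> verts ?G"
          "?ab \<in> verts ?G" "?ac \<in> verts ?G" "?bc \<in> verts ?G"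
        using V True by (auto simp: P_def)
      have "2 \<le> card (active k l r {?a, ?b, ?c, ?ab, ?ac, ?bc})"
      proof (rule card_active_hexagon_ge_2)
        fix u i assume "u \<in> {?a, ?b, ?c}" "i < k"
        thus "l u i \<le> r u i"
          using W by (intro box) auto
      next
        fix u v assume "(u, v) \<in> {(?a, ?b), (?b, ?c), (?a, ?c), (?a, ?bc), (?b, ?ac), (?c, ?ab)}"
        thus "\<exists>i<k. separates l r i u v"
          using W by (intro sep) (auto simp: numeral_3_eq_3 Ex_less_Suc2)
      next
        fix u v i assume "(u, v) \<in> {(?a, ?ab), (?b, ?ab), (?a, ?ac), (?c, ?ac), (?b, ?bc), (?c, ?bc)}"
          "i < k"
        thus "\<not> separates l r i u v"
          using W by (intro nonsep) (auto simp: numeral_3_eq_3 All_less_Suc2)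
      qed
      thus ?thesis
        using True by (simp add: P_def)
    next
      case False
      let ?x = "[m1, p, p + 1]" and ?y = "[m1, p + 1, p]"
      have W: "?x \<in> P p" "?y \<in> P p"
        using False by (simp_all add: P_def)
      have "\<exists>i<k. separates l r i ?x ?y"
        using V W by (intro sep) (auto simp: numeral_3_eq_3 Ex_less_Suc2)
      thus ?thesis
        using card_active_ge_1[of ?x "P p" ?y] W False by simp
    qed
  qed
  also have "\<dots> \<le> k"
  proof (rule sum_card_active_le)
    fix p q u v i assume A: "p < q" "q < m2" "u \<in> P p" "v \<in> P q" "i < k"
    show "\<not> separates l r i u v"
    proof (rule nonsep)
      show "u \<in> verts ?G" "v \<in> verts ?G"
        using A P[of p] P[of q] by auto
      show "u \<noteq> v" "\<forall>j<3. u ! j \<le> v ! j"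
        using A by (auto simp: P_def numeral_3_eq_3 All_less_Suc2 split: if_splits)
    qed (fact A)
  qed
  finally show ?thesis .
qed

subsection \<open>Upper bounds\<close>

text \<open>Between comparable points, the jump at the threshold and the change of \<open>g\<close>
  enter the position with opposite signs and differ by at most 1. If \<open>g\<close> falls across
  the threshold, they add up to more than 1.\<close>

lemma TCC_cube_representation:
  fixes g :: "nat \<Rightarrow> nat list \<Rightarrow> nat"
  assumes dir: "\<And>j. j < k \<Longrightarrow> c j < length a"
    and mono: "\<And>j x y. j < k \<Longrightarrow> \<forall>i<length a. x ! i \<le> y ! i \<Longrightarrow> g j x \<le> g j y"
    and sep: "\<And>x y. x \<in> verts (TCC a) \<Longrightarrow> y \<in> verts (TCC a) \<Longrightarrow>
      \<not> (\<forall>i<length a. x ! i \<le> y ! i) \<Longrightarrow> \<not> (\<forall>i<length a. y ! i \<le> x ! i) \<Longrightarrow>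
      \<exists>j<k. (x ! c j \<le> t j \<and> t j < y ! c j \<and> g j y < g j x) \<or>
        (y ! c j \<le> t j \<and> t j < x ! c j \<and> g j x < g j y)"
  shows "\<exists>f. cube_representation k (TCC a) f"
proof -
  let ?V = "verts (TCC a)"
  have "finite (\<Union>j<k. g j ` ?V)"
    using finite_simple_graph_TCC[of a] by (simp add: finite_simple_graph_def)
  then obtain B where "\<forall>n\<in>(\<Union>j<k. g j ` ?V). n \<le> B"
    using finite_nat_set_iff_bounded_le by blast
  hence B: "g j x \<le> B" if "j < k" "x \<in> ?V" for j x
    using that by blast
  \<comment> \<open>Scales \<open>g\<close> into the unit interval, keeping its strict order; the
    divisor is positive even if \<open>B = 0\<close>.\<close>
  define h where "h j x = real (g j x) / (real B + 1)" for j x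
  have h01: "0 \<le> h j x" "h j x \<le> 1" if "j < k" "x \<in> ?V" for j x
    using B[OF that] by (simp_all add: h_def)
  have h_le: "h j x \<le> h j y \<longleftrightarrow> g j x \<le> g j y" for j x y
    by (simp add: h_def divide_le_cancel)
  define \<phi> where "\<phi> j x = (if x ! c j \<le> t j then 0 else 1) - h j x" for j x
  have close: "\<bar>\<phi> j x - \<phi> j y\<bar> \<le> 1"
    if "x \<in> ?V" "y \<in> ?V" "\<forall>i<length a. x ! i \<le> y ! i" "j < k" for x y j
  proof -
    have "h j x \<le> h j y"
      using mono that h_le by simp
    moreover have "x ! c j \<le> y ! c j"
      using that dir by blast
    ultimately show ?thesis
      using h01[of j x] h01[of j y] that by (auto simp: \<phi>_def)
  qed
  have "cube_representation k (TCC a) (\<lambda>v. \<Pi>\<^sub>E i\<in>{..<k}. {\<phi> i v..\<phi> i v + 1})"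
  proof (rule cube_representation_of_positions)
    fix x y assume xy: "x \<in> ?V" "y \<in> ?V" "x \<noteq> y"
    show "adj (TCC a) x y \<longleftrightarrow> (\<forall>j<k. \<bar>\<phi> j x - \<phi> j y\<bar> \<le> 1)"
    proof
      assume "adj (TCC a) x y"
      thus "\<forall>j<k. \<bar>\<phi> j x - \<phi> j y\<bar> \<le> 1"
        using close[OF xy(1,2)] close[OF xy(2,1)] by (auto simp: adj_TCC_iff[OF xy] abs_minus_commute)
    next
      assume le: "\<forall>j<k. \<bar>\<phi> j x - \<phi> j y\<bar> \<le> 1"
      show "adj (TCC a) x y"
      proof (rule ccontr)
        assume "\<not> adj (TCC a) x y"
        then obtain j where j: "j < k"
            "(x ! c j \<le> t j \<and> t j < y ! c j \<and> g j y < g j x) \<or>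
             (y ! c j \<le> t j \<and> t j < x ! c j \<and> g j x < g j y)"
          using sep[OF xy(1,2)] by (auto simp: adj_TCC_iff[OF xy])
        moreover have "\<bar>\<phi> j x - \<phi> j y\<bar> \<le> 1"
          using le j by blast
        ultimately show False
          using h_le[of j x y] h_le[of j y x] by (auto simp: \<phi>_def abs_le_iff)
      qed
    qed
  qed
  thus ?thesis
    by blast
qed

text \<open>A chain has no incomparable pairs, so no threshold is required.\<close>

lemma TCC1_cube: "\<exists>f. cube_representation 0 (TCC [m1]) f"
  by (rule TCC_cube_representation) auto

lemma TCC2_cube: "\<exists>f. cube_representation m1 (TCC [m1, m2]) f"
proof (rule TCC_cube_representation[where c = "\<lambda>_. 0" and t = "\<lambda>j. j" and g = "\<lambda>_ x. x ! 1"])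
  fix x y
  assume V: "x \<in> verts (TCC [m1, m2])" "y \<in> verts (TCC [m1, m2])"
    and inc: "\<not> (\<forall>i<length [m1, m2]. x ! i \<le> y ! i)" "\<not> (\<forall>i<length [m1, m2]. y ! i \<le> x ! i)"
  have "x ! 0 < y ! 0 \<and> y ! 1 < x ! 1 \<or> y ! 0 < x ! 0 \<and> x ! 1 < y ! 1"
    using inc by (auto simp: All_less_Suc2)
  moreover have "x ! 0 \<le> m1" "y ! 0 \<le> m1"
    using V by (auto simp: verts_TCC All_less_Suc2)
  ultimately show "\<exists>j<m1. (x ! 0 \<le> j \<and> j < y ! 0 \<and> y ! 1 < x ! 1) \<or>
      (y ! 0 \<le> j \<and> j < x ! 0 \<and> x ! 1 < y ! 1)"
    \<comment> \<open>The smaller first coordinate is the threshold; it is below \<open>m1\<close>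
      since the larger one is at most \<open>m1\<close>.\<close>
    by (auto intro: exI[of _ "x ! 0"] exI[of _ "y ! 0"])
qed auto

text \<open>Base \<open>n + 1\<close> encoding of lexicographic order: a low digit of at most
  \<open>n\<close> cannot make up for a smaller high digit.\<close>

lemma lex_less:
  fixes s t u v n :: nat
  assumes "s < t \<or> s = t \<and> u < v" "u \<le> n"
  shows "s * (n + 1) + u < t * (n + 1) + v"
  using assms(1)
proof
  assume "s < t"
  hence "(s + 1) * (n + 1) \<le> t * (n + 1)"
    by (intro mult_le_mono1) simp
  with assms(2) show ?thesis
    by simp
qed simp

lemma TCC3_cube: "\<exists>f. cube_representation (m1 + m2) (TCC [m1, m2, m3]) f"
proof -
  let ?V = "verts (TCC [m1, m2, m3])"
  \<comment> \<open>The first \<open>m1\<close> indices are thresholds in direction 0, the other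
    \<open>m2\<close> are thresholds in direction 1, shifted by \<open>m1\<close>.\<close>
  define c where "c j = (if j < m1 then 0 else 1 :: nat)" for j
  define t where "t j = (if j < m1 then j else j - m1)" for j
  \<comment> \<open>The tie-break by \<open>x ! 1\<close> serves incomparable pairs with equal last
    coordinates.\<close>
  define g where "g j x = (if j < m1 then x ! 2 * (m2 + 1) + x ! 1 else x ! 2)"
    for j and x :: "nat list"
  define S where "S x y \<longleftrightarrow> (\<exists>j<m1 + m2. x ! c j \<le> t j \<and> t j < y ! c j \<and> g j y < g j x)" for x y
  have S0: "S x y" if "x \<in> ?V" "y \<in> ?V" "x ! 0 < y ! 0"
      "y ! 2 < x ! 2 \<or> y ! 2 = x ! 2 \<and> y ! 1 < x ! 1" for x y
  proof -
    have "y ! 0 \<le> m1" "y ! 1 \<le> m2"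
      using that by (auto simp: verts_TCC All_less_Suc2)
    with that lex_less[of "y ! 2" "x ! 2" "y ! 1" "x ! 1" m2] show ?thesis
      unfolding S_def by (intro exI[of _ "x ! 0"]) (simp add: c_def t_def g_def)
  qed
  have S1: "S x y" if "x \<in> ?V" "y \<in> ?V" "x ! 1 < y ! 1" "y ! 2 < x ! 2" for x y
  proof -
    have "y ! 1 \<le> m2"
      using that by (auto simp: verts_TCC All_less_Suc2)
    with that show ?thesis
      unfolding S_def by (intro exI[of _ "m1 + x ! 1"]) (simp add: c_def t_def g_def)
  qed
  show ?thesis
  proof (rule TCC_cube_representation[where c = c and t = t and g = g])
    fix x y assume V: "x \<in> ?V" "y \<in> ?V"
      and inc: "\<not> (\<forall>i<length [m1, m2, m3]. x ! i \<le> y ! i)"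
        "\<not> (\<forall>i<length [m1, m2, m3]. y ! i \<le> x ! i)"
    have "S x y \<or> S y x"
    proof -
      \<comment> \<open>If the last coordinates differ, an opposite order in direction 0 or 1 gives
        \<open>S0\<close> or \<open>S1\<close>; if they agree, the first two are opposed and
        \<open>S0\<close> applies through the tie-break.\<close>
      have "x ! 0 > y ! 0 \<or> x ! 1 > y ! 1 \<or> x ! 2 > y ! 2"
          "x ! 0 < y ! 0 \<or> x ! 1 < y ! 1 \<or> x ! 2 < y ! 2"
        using inc by (auto simp: All_less_Suc2 numeral_2_eq_2 not_le)
      thus ?thesis
        using S0[OF V] S0[OF V(2,1)] S1[OF V] S1[OF V(2,1)] by linarith
    qed
    thus "\<exists>j<m1 + m2. (x ! c j \<le> t j \<and> t j < y ! c j \<and> g j y < g j x) \<or>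
        (y ! c j \<le> t j \<and> t j < x ! c j \<and> g j x < g j y)"
      unfolding S_def by blast
  next
    fix j and x y :: "nat list"
    assume "\<forall>i<length [m1, m2, m3]. x ! i \<le> y ! i"
    hence "x ! 1 \<le> y ! 1" "x ! 2 \<le> y ! 2"
      by simp_all
    thus "g j x \<le> g j y"
      by (simp add: g_def add_mono)
  qed (auto simp: c_def)
qed

theorem corollary2:
  fixes m1 m2 m3 :: nat
  assumes "1 \<le> m1" and "m1 \<le> m2" and "m2 \<le> m3"
  shows "(boxicity (TCC [m1]) = 0 \<and> cubicity (TCC [m1]) = 0) \<and>
         (boxicity (TCC [m1, m2]) = m1 \<and> cubicity (TCC [m1, m2]) = m1) \<and>
         (boxicity (TCC [m1, m2, m3]) = m1 + m2 \<and> cubicity (TCC [m1, m2, m3]) = m1 + m2)"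
proof (intro conjI[OF _ conjI])
  show "boxicity (TCC [m1]) = 0 \<and> cubicity (TCC [m1]) = 0"
    using TCC1_cube boxicity_cubicity_eqI by blast
  show "boxicity (TCC [m1, m2]) = m1 \<and> cubicity (TCC [m1, m2]) = m1"
    using TCC2_cube boxicity_cubicity_eqI box_TCC2_ge assms(2) by blast
  show "boxicity (TCC [m1, m2, m3]) = m1 + m2 \<and> cubicity (TCC [m1, m2, m3]) = m1 + m2"
    using TCC3_cube boxicity_cubicity_eqI box_TCC3_ge assms(2,3) by blast
qed

end
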